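(* Let $R$ be a commutative based ring and let $$R=R^{(0)}\supseteq R^{(1)}\supseteq\cdots\supseteq R^{(n)}\supseteq\cdots,\qquad \mathbb{Z}1=R_{(0)}\subseteq R_{(1)}\subseteq\cdots\subseteq R_{(n)}\subseteq\cdots$$ be the upper and lower central series of $R$. Then $R^{(n)}=\mathbb{Z}1$ if and only if $R_{(n)}=R$, and when this is the case one has $R^{(k)}\subseteq R_{(n-k)}$ for all $k=0,\dots,n$.
   Context: A based ring is a pair $(R,B)$ where $R$ is a ring with identity, free of finite rank as a $\mathbb{Z}$-module, and $B=\{X_i\}_{i\in\mathcal{I}}$ is a $\mathbb{Z}$-basis of $R$ (its elements are called basic) such that $X_iX_j=\sum_{k}c_{ij}^kX_k$ with all $c_{ij}^k$ non-negative integers, the identity $1$ belongs to $B$ (all based rings are unital), and there is an involution $i\mapsto i^*$ of $\mathcal{I}$ whose induced map $X=\sum a_iX_i\mapsto X^*=\sum a_iX_{i^*}$ satisfies $(XY,Z)=(X,ZY^* )=(Y,X^*Z)$ for all $X,Y,Z\in R$, where $(\sum a_iX_i,\sum b_iX_i)=\sum a_ib_i$. A based subring is a subring spanned by a subset of $B$ that is itself a based ring with that basis. For a based ring $R$, $R_{ad}$ is the minimal based subring of $R$ containing $X_iX_i^*$ for all $i\in\mathcal{I}$. The upper central series of $R$ is defined by $R^{(0)}=R$, $R^{(n)}=(R^{(n-1)})_{ad}$ for $n\ge1$. For a based subring $S$ of a commutative based ring $R$, the commutator $S^{co}$ of $S$ in $R$ is the based subring of $R$ generated by all basic elements $Y\in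 R$ such that $YY^*\in S$. The lower central series of $R$ is defined by $R_{(0)}=\mathbb{Z}1$, $R_{(1)}=R_{pt}$ (the based subring spanned by the invertible basic elements of $R$), and $R_{(n)}=(R_{(n-1)})^{co}$ for every integer $n\ge1$ (commutator taken in $R$; the two descriptions of $R_{(1)}$ agree). *)

theory Defs
  imports "HOL-Algebra.Subrings"
begin

definition int_comb :: "('a, 'm) ring_scheme \<Rightarrow> 'a set \<Rightarrow> ('a \<Rightarrow> int) \<Rightarrow> 'a"
  where "int_comb R C c = (\<Oplus>\<^bsub>R\<^esub>x\<in>C. [c x] \<cdot>\<^bsub>R\<^esub> x)"

definition int_span :: "('a, 'm) ring_scheme \<Rightarrow> 'a set \<Rightarrow> 'a set"
  where "int_span R C = {int_comb R C c |c. True}"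

text \<open>A finite basis over the integers. The basis is indexed by its own elements; coefficient
  functions are made unique by requiring them to vanish off the basis.\<close>

definition int_basis :: "('a, 'm) ring_scheme \<Rightarrow> 'a set \<Rightarrow> bool"
  where "int_basis R B \<longleftrightarrow> finite B \<and> B \<subseteq> carrier R \<and>
    (\<forall>x\<in>carrier R. \<exists>!c. (\<forall>b. b \<notin> B \<longrightarrow> c b = 0) \<and> x = int_comb R B c)"

definition coeff_fun :: "('a, 'm) ring_scheme \<Rightarrow> 'a set \<Rightarrow> 'a \<Rightarrow> 'a \<Rightarrow> int"
  where "coeff_fun R B x = (THE c. (\<forall>b. b \<notin> B \<longrightarrow> c b = 0) \<and> x = int_comb R B c)"

definition basis_form :: "('a, 'm) ring_scheme \<Rightarrow> 'a set \<Rightarrow> 'a \<Rightarrow> 'a \<Rightarrow> int"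
  where "basis_form R B x y = (\<Sum>b\<in>B. coeff_fun R B x b * coeff_fun R B y b)"

definition induced_map :: "('a, 'm) ring_scheme \<Rightarrow> 'a set \<Rightarrow> ('a \<Rightarrow> 'a) \<Rightarrow> 'a \<Rightarrow> 'a"
  where "induced_map R B \<sigma> x = (\<Oplus>\<^bsub>R\<^esub>b\<in>B. [coeff_fun R B x b] \<cdot>\<^bsub>R\<^esub> \<sigma> b)"

definition based_involution :: "('a, 'm) ring_scheme \<Rightarrow> 'a set \<Rightarrow> ('a \<Rightarrow> 'a) \<Rightarrow> bool"
  where "based_involution R B \<sigma> \<longleftrightarrow>
    \<sigma> \<in> B \<rightarrow> B \<and> (\<forall>b\<in>B. \<sigma> (\<sigma> b) = b) \<and>
    (\<forall>x\<in>carrier R. \<forall>y\<in>carrier R. \<forall>z\<in>carrier R.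
       basis_form R B (x \<otimes>\<^bsub>R\<^esub> y) z = basis_form R B x (z \<otimes>\<^bsub>R\<^esub> induced_map R B \<sigma> y) \<and>
       basis_form R B (x \<otimes>\<^bsub>R\<^esub> y) z = basis_form R B y (induced_map R B \<sigma> x \<otimes>\<^bsub>R\<^esub> z))"

locale based_ring = ring R for R (structure) +
  fixes B
  assumes basis: "int_basis R B"
    and structure_constants_nonneg:
      "\<lbrakk>x \<in> B; y \<in> B; z \<in> B\<rbrakk> \<Longrightarrow> coeff_fun R B (x \<otimes> y) z \<ge> 0"
    and one_basic: "\<one> \<in> B"
    and ex_involution: "\<exists>\<sigma>. based_involution R B \<sigma>"

locale comm_based_ring = based_ring R B + cring R for R (structure) and B

text \<open>The choice is harmless: the value of the involution at a basic element is determined by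
  the based ring, since the coefficient of a basic \<open>y\<close> in \<open>x\<^sup>*\<close> equals the coefficient of the
  identity in \<open>x \<otimes> y\<close>.\<close>

definition star :: "('a, 'm) ring_scheme \<Rightarrow> 'a set \<Rightarrow> 'a \<Rightarrow> 'a"
  where "star R B = induced_map R B (SOME \<sigma>. based_involution R B \<sigma>)"

text \<open>If \<open>S\<close> is a based subring of \<open>(R, B)\<close>, then the set \<open>C\<close> below is necessarily \<open>B \<inter> S\<close>.\<close>

definition based_subring :: "'a set \<Rightarrow> ('a, 'm) ring_scheme \<Rightarrow> 'a set \<Rightarrow> bool"
  where "based_subring S R B \<longleftrightarrow> subring S R \<and>
    (\<exists>C\<subseteq>B. S = int_span R C \<and> based_ring (R\<lparr>carrier := S\<rparr>) C)"

definition based_generated :: "('a, 'm) ring_scheme \<Rightarrow> 'a set \<Rightarrow> 'a set \<Rightarrow> 'a set"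
  where "based_generated R B A = \<Inter>{S. based_subring S R B \<and> A \<subseteq> S}"

definition adjoint_subring :: "('a, 'm) ring_scheme \<Rightarrow> 'a set \<Rightarrow> 'a set"
  where "adjoint_subring R B = based_generated R B {x \<otimes>\<^bsub>R\<^esub> star R B x |x. x \<in> B}"

definition commutator :: "('a, 'm) ring_scheme \<Rightarrow> 'a set \<Rightarrow> 'a set \<Rightarrow> 'a set"
  where "commutator R B S = based_generated R B {y \<in> B. y \<otimes>\<^bsub>R\<^esub> star R B y \<in> S}"

primrec upper_central :: "('a, 'm) ring_scheme \<Rightarrow> 'a set \<Rightarrow> nat \<Rightarrow> 'a set"
  where
    "upper_central R B 0 = carrier R"
  | "upper_central R B (Suc n) =
       adjoint_subring (R\<lparr>carrier := upper_central R B n\<rparr>) (B \<inter> upper_central R B n)"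

text \<open>The first step yields the pointed subring, spanned by the basic \<open>y\<close> with
  \<open>y \<otimes> y\<^sup>* = \<one>\<close>: the coefficient of the identity in \<open>y \<otimes> y\<^sup>*\<close> is always 1.\<close>

primrec lower_central :: "('a, 'm) ring_scheme \<Rightarrow> 'a set \<Rightarrow> nat \<Rightarrow> 'a set"
  where
    "lower_central R B 0 = int_span R {\<one>\<^bsub>R\<^esub>}"
  | "lower_central R B (Suc n) = commutator R B (lower_central R B n)"

end

theory Submission
  imports Defs
begin

text \<open>The two central series are exchanged by a Galois connection. For based subrings \<open>S\<close> and
  \<open>T\<close> of a commutative based ring, \<open>T\<^sub>a\<^sub>d \<subseteq> S\<close> holds iff \<open>T \<subseteq> S\<^sup>c\<^sup>o\<close>
  (\<open>adjoint_commutator_galois\<close>): both say that \<open>XX\<^sup>* \<in> S\<close> for every basic \<open>X\<close> of \<open>T\<close>.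
  Iterating the equivalence moves steps of the upper series into steps of the lower one, so that
  \<open>R\<^sup>(\<^sup>n\<^sup>) \<subseteq> R\<^sub>(\<^sub>0\<^sub>)\<close> is equivalent to \<open>R\<^sup>(\<^sup>k\<^sup>) \<subseteq> R\<^sub>(\<^sub>n\<^sub>-\<^sub>k\<^sub>)\<close> for each
  \<open>k \<le> n\<close>. The case \<open>k = n\<close> says \<open>R\<^sup>(\<^sup>n\<^sup>) = \<int>1\<close>, the case \<open>k = 0\<close> says
  \<open>R\<^sub>(\<^sub>n\<^sub>) = R\<close>, and the remaining cases are the inclusions between the two series.

  The description of \<open>T\<^sub>a\<^sub>d \<subseteq> S\<close> is nearly a matter of definition, once one knows that an
  intersection of based subrings is a based subring and that a based subring of \<open>T\<close> is the same as
  one of \<open>R\<close> contained in \<open>T\<close>. The description of \<open>T \<subseteq> S\<^sup>c\<^sup>o\<close> needs the basic elements of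
  \<open>S\<^sup>c\<^sup>o\<close>, which is only given by generators: there must be none besides the generators, the basic
  \<open>Y\<close> with \<open>YY\<^sup>* \<in> S\<close> (\<open>fusion_closed_commutator\<close>). If \<open>Y\<close> and \<open>Z\<close> are two of
  these and \<open>X\<close> occurs in \<open>YZ\<close>, then every basic element that occurs in \<open>XX\<^sup>*\<close> occurs in
  \<open>YZ(YZ)\<^sup>* = (YY\<^sup>*)(ZZ\<^sup>*) \<in> S\<close>, since structure constants are not negative and nothing
  cancels. Commutativity enters in this rearrangement.

  All of this rests on a combinatorial description (\<open>based_subring_iff\<close>): based subrings are the
  spans of the sets of basic elements that contain the identity and are closed under duals and
  under the constituents of products.\<close>

section \<open>Integer combinations\<close>

context ring
begin

lemma int_mult_closed: "x \<in> carrier R \<Longrightarrow> [(k::int)] \<cdot> x \<in> carrier R"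
  unfolding add_pow_def using group.int_pow_closed[OF a_group] by simp

lemma int_mult_0: "[(0::int)] \<cdot> x = \<zero>"
  by (simp add: add_pow_def int_pow_def2)

lemma int_mult_1: "x \<in> carrier R \<Longrightarrow> [(1::int)] \<cdot> x = x"
  unfolding add_pow_def using group.int_pow_1[OF a_group] by simp

lemma int_mult_zero: "[(k::int)] \<cdot> \<zero> = \<zero>"
  unfolding add_pow_def using group.int_pow_one[OF a_group] by simp

lemma int_mult_add:
  "x \<in> carrier R \<Longrightarrow> [(j + k::int)] \<cdot> x = [j] \<cdot> x \<oplus> [k] \<cdot> x"
  unfolding add_pow_def using group.int_pow_mult[OF a_group] by simp

lemma int_mult_mult:
  "x \<in> carrier R \<Longrightarrow> [(j * k::int)] \<cdot> x = [j] \<cdot> ([k] \<cdot> x)"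
  unfolding add_pow_def using group.int_pow_pow[OF a_group] by (simp add: mult.commute)

lemma int_mult_finsum:
  assumes "f \<in> A \<rightarrow> carrier R"
  shows "[(k::int)] \<cdot> (\<Oplus>i\<in>A. f i) = (\<Oplus>i\<in>A. [k] \<cdot> f i)"
  using assms
proof (induction A rule: infinite_finite_induct)
  case (insert a A)
  then have "f a \<in> carrier R" "f \<in> A \<rightarrow> carrier R" by auto
  then show ?case
    using insert comm_group.int_pow_distrib[OF a_comm_group, of "f a" "finsum R f A" k]
    by (simp add: int_mult_closed Pi_def add_pow_def[symmetric])
qed (simp_all add: int_mult_zero)

lemma int_comb_closed: "C \<subseteq> carrier R \<Longrightarrow> int_comb R C c \<in> carrier R"
  unfolding int_comb_def by (intro finsum_closed) (auto simp: int_mult_closed)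

lemma int_comb_cong:
  "C \<subseteq> carrier R \<Longrightarrow> (\<And>x. x \<in> C \<Longrightarrow> c x = d x) \<Longrightarrow> int_comb R C c = int_comb R C d"
  unfolding int_comb_def by (rule finsum_cong') (auto simp: int_mult_closed)

lemma int_comb_extend:
  assumes "finite D" "C \<subseteq> D" "D \<subseteq> carrier R" "\<And>x. x \<in> D - C \<Longrightarrow> c x = 0"
  shows "int_comb R C c = int_comb R D c"
  unfolding int_comb_def
  by (rule add.finprod_mono_neutral_cong_left) (use assms in \<open>auto simp: int_mult_closed int_mult_0\<close>)

lemma int_comb_add:
  assumes "C \<subseteq> carrier R"
  shows "int_comb R C (\<lambda>x. c x + d x) = int_comb R C c \<oplus> int_comb R C d"
proof -
  have "int_comb R C (\<lambda>x. c x + d x) = (\<Oplus>x\<in>C. [c x] \<cdot> x \<oplus> [d x] \<cdot> x)"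
    unfolding int_comb_def by (rule finsum_cong') (use assms in \<open>auto simp: int_mult_add int_mult_closed\<close>)
  also have "\<dots> = int_comb R C c \<oplus> int_comb R C d"
    unfolding int_comb_def by (rule finsum_addf) (use assms in \<open>auto simp: int_mult_closed\<close>)
  finally show ?thesis .
qed

lemma int_comb_int_mult:
  assumes "C \<subseteq> carrier R"
  shows "int_comb R C (\<lambda>x. k * c x) = [k] \<cdot> int_comb R C c"
proof -
  have "int_comb R C (\<lambda>x. k * c x) = (\<Oplus>x\<in>C. [k] \<cdot> ([c x] \<cdot> x))"
    unfolding int_comb_def by (rule finsum_cong') (use assms in \<open>auto simp: int_mult_mult int_mult_closed\<close>)
  then show ?thesis
    unfolding int_comb_def using assms by (subst int_mult_finsum) (auto simp: int_mult_closed)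
qed

lemma int_comb_delta:
  assumes "finite C" "C \<subseteq> carrier R" "x \<in> C"
  shows "int_comb R C (\<lambda>y. if y = x then 1 else 0) = x"
proof -
  have "int_comb R {x} (\<lambda>y. if y = x then 1 else 0) = int_comb R C (\<lambda>y. if y = x then 1 else 0)"
    by (rule int_comb_extend) (use assms in auto)
  then show ?thesis
    using assms by (auto simp: int_comb_def int_mult_1)
qed

text \<open>The additive structure of a subring is inherited, but sums and multiples are defined
  relative to a carrier, so that their agreement has to be established.\<close>

lemma subring_finsum:
  assumes "subring S R" "f \<in> A \<rightarrow> S"
  shows "finsum (R\<lparr>carrier := S\<rparr>) f A = finsum R f A"
proof -
  interpret S: ring "R\<lparr>carrier := S\<rparr>" using assms(1) by (rule subring_is_ring)
  have "S \<subseteq> carrier R" using assms(1) by (rule subringE)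
  with assms(2) show ?thesis
  proof (induction A rule: infinite_finite_induct)
    case (insert a A)
    then have "f \<in> A \<rightarrow> S" "f a \<in> S" by auto
    moreover from this have "f \<in> A \<rightarrow> carrier R" "f a \<in> carrier R" using insert by auto
    ultimately show ?case using insert by simp
  next
    case (infinite A)
    then show ?case by (simp add: finsum_def finprod_def)
  next
    case empty
    then show ?case using S.finsum_empty[of f] by simp
  qed
qed

lemma subring_int_mult:
  assumes "subring S R" "x \<in> S"
  shows "[(k::int)] \<cdot>\<^bsub>R\<lparr>carrier := S\<rparr>\<^esub> x = [k] \<cdot> x"
proof -
  have "subgroup S (add_monoid R)" using assms(1) by (rule subring.axioms)
  then show ?thesis
    using group.int_pow_consistent[OF a_group, of S x k] assms(2) by (simp add: add_pow_def)
qed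

lemma subring_int_mult_closed:
  assumes "subring S R" "x \<in> S"
  shows "[(k::int)] \<cdot> x \<in> S"
proof -
  interpret S: ring "R\<lparr>carrier := S\<rparr>" using assms(1) by (rule subring_is_ring)
  show ?thesis using S.int_mult_closed[of x k] assms by (simp add: subring_int_mult)
qed

lemma subring_int_comb:
  assumes "subring S R" "C \<subseteq> S"
  shows "int_comb (R\<lparr>carrier := S\<rparr>) C c = int_comb R C c"
proof -
  interpret S: ring "R\<lparr>carrier := S\<rparr>" using assms(1) by (rule subring_is_ring)
  have "int_comb (R\<lparr>carrier := S\<rparr>) C c = finsum (R\<lparr>carrier := S\<rparr>) (\<lambda>x. [c x] \<cdot> x) C"
    unfolding int_comb_def
    by (rule S.finsum_cong') (use assms in \<open>auto simp: subring_int_mult subring_int_mult_closed\<close>)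
  also have "\<dots> = int_comb R C c"
    unfolding int_comb_def
    by (rule subring_finsum) (use assms in \<open>auto simp: subring_int_mult_closed\<close>)
  finally show ?thesis .
qed

lemma subring_int_span:
  "subring S R \<Longrightarrow> C \<subseteq> S \<Longrightarrow> int_span (R\<lparr>carrier := S\<rparr>) C = int_span R C"
  by (simp add: int_span_def subring_int_comb)

lemma int_span_subset_subring:
  assumes "subring S R" "C \<subseteq> S"
  shows "int_span R C \<subseteq> S"
proof -
  interpret S: ring "R\<lparr>carrier := S\<rparr>" using assms(1) by (rule subring_is_ring)
  show ?thesis
    using S.int_comb_closed[of C] assms by (auto simp: int_span_def subring_int_comb)
qed

end

section \<open>Coefficients\<close>

context based_ring
begin

abbreviation coeff where "coeff \<equiv> coeff_fun R B"

lemma finite_basis: "finite B" and basis_subset: "B \<subseteq> carrier R"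
  using basis by (auto simp: int_basis_def)

lemma basis_closed [simp]: "b \<in> B \<Longrightarrow> b \<in> carrier R"
  using basis_subset by auto

lemma coeff_properties:
  assumes "x \<in> carrier R"
  shows coeff_outside: "b \<notin> B \<Longrightarrow> coeff x b = 0"
    and int_comb_coeff: "int_comb R B (coeff x) = x"
proof -
  have "\<exists>!c. (\<forall>b. b \<notin> B \<longrightarrow> c b = 0) \<and> x = int_comb R B c"
    using basis assms by (auto simp: int_basis_def)
  from theI'[OF this] show "b \<notin> B \<Longrightarrow> coeff x b = 0" "int_comb R B (coeff x) = x"
    unfolding coeff_fun_def by auto
qed

lemma coeff_unique:
  assumes "\<And>b. b \<notin> B \<Longrightarrow> c b = 0" "x = int_comb R B c"
  shows "coeff x = c"
proof -
  have "x \<in> carrier R" using assms(2) basis_subset by (simp add: int_comb_closed)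
  then have "\<exists>!c. (\<forall>b. b \<notin> B \<longrightarrow> c b = 0) \<and> x = int_comb R B c"
    using basis by (auto simp: int_basis_def)
  then show ?thesis unfolding coeff_fun_def using assms by (intro the1_equality) auto
qed

lemma coeff_basic:
  assumes "x \<in> B"
  shows "coeff x = (\<lambda>b. if b = x then 1 else 0)"
  using assms int_comb_delta[OF finite_basis basis_subset assms] by (intro coeff_unique) auto

lemma coeff_add:
  assumes "x \<in> carrier R" "y \<in> carrier R"
  shows "coeff (x \<oplus> y) b = coeff x b + coeff y b"
proof -
  have "coeff (x \<oplus> y) = (\<lambda>b. coeff x b + coeff y b)"
    by (rule coeff_unique)
      (use assms basis_subset in \<open>auto simp: int_comb_add int_comb_coeff coeff_outside\<close>)
  then show ?thesis by simp
qed

lemma coeff_int_mult: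
  assumes "x \<in> carrier R"
  shows "coeff ([(k::int)] \<cdot> x) b = k * coeff x b"
proof -
  have "coeff ([k] \<cdot> x) = (\<lambda>b. k * coeff x b)"
    by (rule coeff_unique)
      (use assms basis_subset in \<open>auto simp: int_comb_int_mult int_comb_coeff coeff_outside\<close>)
  then show ?thesis by simp
qed

lemma coeff_zero: "coeff \<zero> b = 0"
  using coeff_int_mult[of \<zero> 0 b] by (simp add: int_mult_0)

lemma coeff_finsum:
  assumes "finite A" "f \<in> A \<rightarrow> carrier R"
  shows "coeff (\<Oplus>i\<in>A. f i) b = (\<Sum>i\<in>A. coeff (f i) b)"
  using assms
proof (induction A rule: finite_induct)
  case (insert a A)
  then have "f a \<in> carrier R" "f \<in> A \<rightarrow> carrier R" by auto
  then show ?case using insert by (simp add: coeff_add)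
qed (simp add: coeff_zero)

lemma coeff_mult_left:
  assumes "x \<in> carrier R" "y \<in> carrier R"
  shows "coeff (x \<otimes> y) k = (\<Sum>i\<in>B. coeff x i * coeff (i \<otimes> y) k)"
proof -
  have "x \<otimes> y = (\<Oplus>i\<in>B. [coeff x i] \<cdot> i) \<otimes> y"
    using int_comb_coeff[OF assms(1)] by (simp add: int_comb_def)
  also have "\<dots> = (\<Oplus>i\<in>B. [coeff x i] \<cdot> i \<otimes> y)"
    by (rule finsum_ldistr) (use assms finite_basis in \<open>auto simp: int_mult_closed\<close>)
  finally have "coeff (x \<otimes> y) k = (\<Sum>i\<in>B. coeff ([coeff x i] \<cdot> i \<otimes> y) k)"
    using assms finite_basis by (simp add: coeff_finsum int_mult_closed Pi_def)
  then show ?thesis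
    using assms by (simp add: add_pow_ldistr_int coeff_int_mult)
qed

lemma coeff_mult_right:
  assumes "x \<in> carrier R" "y \<in> carrier R"
  shows "coeff (x \<otimes> y) k = (\<Sum>j\<in>B. coeff y j * coeff (x \<otimes> j) k)"
proof -
  have "x \<otimes> y = x \<otimes> (\<Oplus>i\<in>B. [coeff y i] \<cdot> i)"
    using int_comb_coeff[OF assms(2)] by (simp add: int_comb_def)
  also have "\<dots> = (\<Oplus>i\<in>B. x \<otimes> [coeff y i] \<cdot> i)"
    by (rule finsum_rdistr) (use assms finite_basis in \<open>auto simp: int_mult_closed\<close>)
  finally have "coeff (x \<otimes> y) k = (\<Sum>i\<in>B. coeff (x \<otimes> [coeff y i] \<cdot> i) k)"
    using assms finite_basis by (simp add: coeff_finsum int_mult_closed Pi_def)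
  then show ?thesis
    using assms by (simp add: add_pow_rdistr_int coeff_int_mult)
qed

lemma coeff_mult:
  assumes "x \<in> carrier R" "y \<in> carrier R"
  shows "coeff (x \<otimes> y) k = (\<Sum>i\<in>B. \<Sum>j\<in>B. coeff x i * coeff y j * coeff (i \<otimes> j) k)"
proof -
  have "coeff (i \<otimes> y) k = (\<Sum>j\<in>B. coeff y j * coeff (i \<otimes> j) k)" if "i \<in> B" for i
    using that assms by (intro coeff_mult_right) auto
  then show ?thesis
    by (simp add: coeff_mult_left[OF assms] sum_distrib_left mult.assoc)
qed

text \<open>With non-negative coefficients nothing cancels, so a single term of the expansion bounds the
  coefficient from below. This is how constituents of products are detected.\<close>

lemma coeff_mult_ge:
  assumes "x \<in> carrier R" "y \<in> carrier R" "i \<in> B" "j \<in> B" "k \<in> B"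
    and x: "\<And>b. b \<in> B \<Longrightarrow> coeff x b \<ge> 0" and y: "\<And>b. b \<in> B \<Longrightarrow> coeff y b \<ge> 0"
  shows "coeff x i * coeff y j * coeff (i \<otimes> j) k \<le> coeff (x \<otimes> y) k"
proof -
  let ?f = "\<lambda>i j. coeff x i * coeff y j * coeff (i \<otimes> j) k"
  have nonneg: "?f i j \<ge> 0" if "i \<in> B" "j \<in> B" for i j
    using that x y assms(5) structure_constants_nonneg by simp
  have "?f i j \<le> (\<Sum>j\<in>B. ?f i j)"
    by (rule member_le_sum) (use assms finite_basis nonneg in auto)
  also have "\<dots> \<le> (\<Sum>i\<in>B. \<Sum>j\<in>B. ?f i j)"
    by (rule member_le_sum[of i B "\<lambda>i. \<Sum>j\<in>B. ?f i j"])
      (use assms finite_basis nonneg in \<open>auto intro: sum_nonneg\<close>)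
  finally show ?thesis by (simp add: coeff_mult[OF assms(1,2)])
qed

lemma int_span_iff:
  assumes "C \<subseteq> B"
  shows "x \<in> int_span R C \<longleftrightarrow> x \<in> carrier R \<and> (\<forall>b\<in>B - C. coeff x b = 0)"
proof
  assume "x \<in> int_span R C"
  then obtain c where x: "x = int_comb R C c" by (auto simp: int_span_def)
  let ?d = "\<lambda>b. if b \<in> C then c b else 0"
  have "x = int_comb R C ?d"
    unfolding x by (rule int_comb_cong) (use assms basis_subset in auto)
  also have "\<dots> = int_comb R B ?d"
    by (rule int_comb_extend) (use assms basis_subset finite_basis in auto)
  finally have "coeff x = ?d"
    by (intro coeff_unique) (use assms in auto)
  moreover have "x \<in> carrier R"
    unfolding x by (rule int_comb_closed) (use assms basis_subset in auto)
  ultimately show "x \<in> carrier R \<and> (\<forall>b\<in>B - C. coeff x b = 0)" by simp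
next
  assume x: "x \<in> carrier R \<and> (\<forall>b\<in>B - C. coeff x b = 0)"
  have "int_comb R C (coeff x) = int_comb R B (coeff x)"
    by (rule int_comb_extend) (use assms basis_subset finite_basis x in auto)
  then have "x = int_comb R C (coeff x)" using x int_comb_coeff by simp
  then show "x \<in> int_span R C" unfolding int_span_def by blast
qed

lemma int_span_superset: "C \<subseteq> B \<Longrightarrow> C \<subseteq> int_span R C"
proof
  fix x assume "C \<subseteq> B" "x \<in> C"
  moreover from this have "x \<in> B" by auto
  ultimately show "x \<in> int_span R C" by (auto simp: int_span_iff coeff_basic)
qed

lemma basis_inter_int_span:
  assumes "C \<subseteq> B"
  shows "B \<inter> int_span R C = C"
proof
  show "B \<inter> int_span R C \<subseteq> C"
  proof
    fix b assume "b \<in> B \<inter> int_span R C"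
    then have "b \<in> B" "\<forall>d\<in>B - C. coeff b d = 0" using int_span_iff[OF assms] by auto
    moreover from this have "coeff b b = 1" by (simp add: coeff_basic)
    ultimately show "b \<in> C" by force
  qed
  show "C \<subseteq> B \<inter> int_span R C" using assms int_span_superset[OF assms] by simp
qed

lemma int_span_basis: "int_span R B = carrier R"
  by (auto simp: int_span_iff)

lemma int_span_Inter:
  assumes "\<C> \<noteq> {}" "\<And>C. C \<in> \<C> \<Longrightarrow> C \<subseteq> B"
  shows "(\<Inter>C\<in>\<C>. int_span R C) = int_span R (\<Inter>\<C>)"
proof -
  have "\<Inter>\<C> \<subseteq> B" using assms by auto
  note iff = int_span_iff[OF this] int_span_iff[OF assms(2)]
  have "x \<in> (\<Inter>C\<in>\<C>. int_span R C) \<longleftrightarrow> x \<in> int_span R (\<Inter>\<C>)" for x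
    using assms(1) by (simp add: iff) blast
  then show ?thesis by blast
qed

section \<open>The involution\<close>

abbreviation dual where "dual \<equiv> star R B"

lemma basis_form_basic:
  assumes "b \<in> B"
  shows "basis_form R B x b = coeff x b" and "basis_form R B b x = coeff x b"
  using assms finite_basis by (simp_all add: basis_form_def coeff_basic if_distrib if_distribR
      cong: if_cong)

lemma induced_map_basic:
  assumes "\<sigma> \<in> B \<rightarrow> B" "b \<in> B"
  shows "induced_map R B \<sigma> b = \<sigma> b"
proof -
  have "\<sigma> b = (\<Oplus>x\<in>B. if x = b then \<sigma> x else \<zero>)"
    using assms finite_basis basis_subset by (subst add.finprod_singleton_swap) auto
  also have "\<dots> = induced_map R B \<sigma> b"
    unfolding induced_map_def
    by (rule finsum_cong')
      (use assms in \<open>auto simp: coeff_basic int_mult_0 int_mult_1 int_mult_closed Pi_def\<close>)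
  finally show ?thesis by simp
qed

lemma based_involution_star:
  obtains \<sigma> where "based_involution R B \<sigma>" "dual = induced_map R B \<sigma>"
  using someI_ex[OF ex_involution] by (auto simp: star_def)

lemma dual_closed [simp]: "b \<in> B \<Longrightarrow> dual b \<in> B"
  and dual_dual [simp]: "b \<in> B \<Longrightarrow> dual (dual b) = b"
  using based_involution_star by (force simp: based_involution_def induced_map_basic Pi_iff)+

lemma coeff_mult_dual:
  assumes "x \<in> B" "y \<in> B" "z \<in> B"
  shows coeff_mult_dual_right: "coeff (x \<otimes> y) z = coeff (z \<otimes> dual y) x"
    and coeff_mult_dual_left: "coeff (x \<otimes> y) z = coeff (dual x \<otimes> z) y"
proof -
  obtain \<sigma> where \<sigma>: "based_involution R B \<sigma>" "dual = induced_map R B \<sigma>"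
    by (rule based_involution_star)
  then have "basis_form R B (x \<otimes> y) z = basis_form R B x (z \<otimes> dual y)"
    "basis_form R B (x \<otimes> y) z = basis_form R B y (dual x \<otimes> z)"
    using assms unfolding based_involution_def by (metis basis_closed)+
  then show "coeff (x \<otimes> y) z = coeff (z \<otimes> dual y) x" "coeff (x \<otimes> y) z = coeff (dual x \<otimes> z) y"
    using assms by (simp_all add: basis_form_basic)
qed

text \<open>The coefficient of the identity pairs each basic element with its dual only, which
  characterises the dual without reference to a choice of involution.\<close>

lemma coeff_mult_one:
  assumes "x \<in> B" "y \<in> B"
  shows "coeff (x \<otimes> y) \<one> = (if y = dual x then 1 else 0)"
  using assms one_basic coeff_mult_dual_left[of x y \<one>] by (auto simp: coeff_basic)

lemma dual_one: "dual \<one> = \<one>"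
  using coeff_mult_one[of \<one> \<one>] one_basic by (auto simp: coeff_basic split: if_splits)

text \<open>On coefficients, the involution is an anti-automorphism. Moving one factor at a time across
  the form gives \<open>(Z\<^sup>*Y\<^sup>*, X\<^sup>*) = (Y\<^sup>*, ZX\<^sup>*) = (Y\<^sup>*X, Z) = (X, YZ)\<close>.\<close>

lemma coeff_mult_dual_swap:
  assumes "x \<in> B" "y \<in> B" "z \<in> B"
  shows "coeff (dual z \<otimes> dual y) (dual x) = coeff (y \<otimes> z) x"
  using assms coeff_mult_dual_left[of "dual z" "dual y" "dual x"]
    coeff_mult_dual_right[of z "dual x" "dual y"] coeff_mult_dual_left[of y z x] by simp

section \<open>Based subrings\<close>

definition fusion_closed :: "'a set \<Rightarrow> bool"
  where "fusion_closed C \<longleftrightarrow> C \<subseteq> B \<and> \<one> \<in> C \<and> dual ` C \<subseteq> C \<and>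
    (\<forall>x\<in>C. \<forall>y\<in>C. \<forall>z\<in>B. coeff (x \<otimes> y) z \<noteq> 0 \<longrightarrow> z \<in> C)"

lemma fusion_closedI:
  assumes "C \<subseteq> B" "\<one> \<in> C" "\<And>x. x \<in> C \<Longrightarrow> dual x \<in> C"
    and "\<And>x y z. x \<in> C \<Longrightarrow> y \<in> C \<Longrightarrow> z \<in> B \<Longrightarrow> coeff (x \<otimes> y) z \<noteq> 0 \<Longrightarrow> z \<in> C"
  shows "fusion_closed C"
  using assms unfolding fusion_closed_def by blast

lemma fusion_closedD:
  assumes "fusion_closed C"
  shows "C \<subseteq> B" and "\<one> \<in> C" and "x \<in> C \<Longrightarrow> dual x \<in> C"
    and "x \<in> C \<Longrightarrow> y \<in> C \<Longrightarrow> z \<in> B \<Longrightarrow> coeff (x \<otimes> y) z \<noteq> 0 \<Longrightarrow> z \<in> C"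
  using assms unfolding fusion_closed_def by blast+

lemma fusion_closed_subring:
  assumes "fusion_closed C"
  shows "subring (int_span R C) R"
proof -
  have C: "C \<subseteq> B" "\<one> \<in> C" by (rule fusion_closedD[OF assms])+
  note iff = int_span_iff[OF C(1)]
  show ?thesis
  proof (rule subringI)
    show "int_span R C \<subseteq> carrier R" using iff by auto
    show "\<one> \<in> int_span R C" using C int_span_superset by auto
  next
    fix x assume x: "x \<in> int_span R C"
    have "coeff (\<ominus> x) b = - coeff x b" for b
      using x iff coeff_add[of x "\<ominus> x" b] by (simp add: r_neg coeff_zero)
    then show "\<ominus> x \<in> int_span R C" using x iff by simp
  next
    fix x y assume x: "x \<in> int_span R C" and y: "y \<in> int_span R C"
    show "x \<oplus> y \<in> int_span R C" using x y iff by (simp add: coeff_add)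
    have x': "x \<in> carrier R" "\<And>b. b \<in> B - C \<Longrightarrow> coeff x b = 0"
      and y': "y \<in> carrier R" "\<And>b. b \<in> B - C \<Longrightarrow> coeff y b = 0"
      using x y iff by auto
    have "coeff (x \<otimes> y) b = 0" if b: "b \<in> B - C" for b
      unfolding coeff_mult[OF x'(1) y'(1)]
    proof (intro sum.neutral ballI)
      fix i j assume ij: "i \<in> B" "j \<in> B"
      have "coeff (i \<otimes> j) b = 0" if "i \<in> C" "j \<in> C"
        using fusion_closedD(4)[OF assms that, of b] b by blast
      then show "coeff x i * coeff y j * coeff (i \<otimes> j) b = 0"
        using ij x'(2)[of i] y'(2)[of j] by (cases "i \<in> C"; cases "j \<in> C") simp_all
    qed
    then show "x \<otimes> y \<in> int_span R C" using x' y' iff by simp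
  qed
qed

text \<open>An integer combination over \<open>C\<close> extends by zero to one over \<open>B\<close>, so uniqueness over
  \<open>B\<close> identifies the two coefficient functions, and one may compute in \<open>R\<close> throughout.\<close>

lemma coeff_fun_subring:
  assumes S: "subring S R" and C: "C \<subseteq> B" "S = int_span R C"
  shows subring_int_basis: "int_basis (R\<lparr>carrier := S\<rparr>) C"
    and subring_coeff: "x \<in> S \<Longrightarrow> coeff_fun (R\<lparr>carrier := S\<rparr>) C x = coeff x"
proof -
  have "C \<subseteq> S" using C int_span_superset by simp
  have key: "(\<forall>b. b \<notin> C \<longrightarrow> c b = 0) \<and> x = int_comb (R\<lparr>carrier := S\<rparr>) C c \<longleftrightarrow> c = coeff x"
    if x: "x \<in> S" for x c
  proof -
    have x': "x \<in> carrier R" "\<And>b. b \<notin> C \<Longrightarrow> coeff x b = 0"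
      using x C int_span_iff[OF C(1)] coeff_outside by blast+
    have ext: "int_comb (R\<lparr>carrier := S\<rparr>) C c = int_comb R B c" if "\<And>b. b \<notin> C \<Longrightarrow> c b = 0" for c
      unfolding subring_int_comb[OF S \<open>C \<subseteq> S\<close>]
      by (rule int_comb_extend[OF finite_basis C(1) basis_subset]) (use that in simp)
    show ?thesis
    proof
      assume c: "(\<forall>b. b \<notin> C \<longrightarrow> c b = 0) \<and> x = int_comb (R\<lparr>carrier := S\<rparr>) C c"
      then have "x = int_comb R B c" using ext[of c] by simp
      then show "c = coeff x" using c C(1) by (intro coeff_unique[symmetric]) auto
    next
      assume "c = coeff x"
      then show "(\<forall>b. b \<notin> C \<longrightarrow> c b = 0) \<and> x = int_comb (R\<lparr>carrier := S\<rparr>) C c"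
        using x' ext[of "coeff x"] int_comb_coeff[of x] by simp
    qed
  qed
  show "int_basis (R\<lparr>carrier := S\<rparr>) C"
    using key \<open>C \<subseteq> S\<close> C(1) finite_basis finite_subset by (auto simp: int_basis_def)
  show "coeff_fun (R\<lparr>carrier := S\<rparr>) C x = coeff x" if "x \<in> S"
    using key[OF that] by (simp add: coeff_fun_def)
qed

text \<open>Products, coefficients, the form and the involution of \<open>R\<close> all restrict to the span of a
  fusion closed set; the axioms of a based ring then hold because they hold in \<open>R\<close>.\<close>

lemma fusion_closed_based_ring:
  assumes "fusion_closed C"
  shows "based_ring (R\<lparr>carrier := int_span R C\<rparr>) C"
proof -
  let ?S = "int_span R C" and ?R = "R\<lparr>carrier := int_span R C\<rparr>"
  have C: "C \<subseteq> B" "\<one> \<in> C" by (rule fusion_closedD[OF assms])+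
  have S: "subring ?S R" using assms by (rule fusion_closed_subring)
  note coeff' = subring_coeff[OF S C(1) refl]
  have CS: "C \<subseteq> ?S" using C int_span_superset by simp
  have SR: "?S \<subseteq> carrier R" using S by (rule subringE)
  have mult: "x \<otimes> y \<in> ?S" if "x \<in> ?S" "y \<in> ?S" for x y
    using S that by (rule subringE)
  obtain \<sigma> where \<sigma>: "based_involution R B \<sigma>" "dual = induced_map R B \<sigma>"
    by (rule based_involution_star)
  then have \<sigma>_dual: "\<sigma> b = dual b" if "b \<in> B" for b
    using that by (simp add: based_involution_def induced_map_basic)
  have \<sigma>C: "\<sigma> \<in> C \<rightarrow> C"
  proof
    fix x assume x: "x \<in> C"
    then show "\<sigma> x \<in> C" using fusion_closedD(3)[OF assms x] \<sigma>_dual[of x] C(1) by auto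
  qed
  have zero: "coeff x b = 0" if "x \<in> ?S" "b \<in> B - C" for x b
    using that int_span_iff[OF C(1)] by blast
  have form: "basis_form ?R C x y = basis_form R B x y" if "x \<in> ?S" "y \<in> ?S" for x y
    unfolding basis_form_def using that C finite_basis
    by (intro sum.mono_neutral_cong_left) (auto simp: coeff' zero)
  have map: "induced_map ?R C \<sigma> x = induced_map R B \<sigma> x" "induced_map ?R C \<sigma> x \<in> ?S"
    if x: "x \<in> ?S" for x
  proof -
    interpret S: ring ?R using S by (rule subring_is_ring)
    have closed: "[coeff x b] \<cdot> \<sigma> b \<in> ?S" if "b \<in> C" for b
      using that \<sigma>C CS S by (auto intro!: subring_int_mult_closed)
    have "induced_map ?R C \<sigma> x = finsum ?R (\<lambda>b. [coeff x b] \<cdot> \<sigma> b) C"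
      unfolding induced_map_def
      by (rule S.finsum_cong')
        (use x \<sigma>C CS S closed in \<open>auto simp: coeff' subring_int_mult Pi_iff subset_iff\<close>)
    moreover have "finsum ?R (\<lambda>b. [coeff x b] \<cdot> \<sigma> b) C = (\<Oplus>b\<in>C. [coeff x b] \<cdot> \<sigma> b)"
      using S closed by (intro subring_finsum) auto
    moreover have "\<dots> = induced_map R B \<sigma> x"
      unfolding induced_map_def
      by (rule add.finprod_mono_neutral_cong_left)
        (use x C finite_basis \<sigma> in \<open>auto simp: zero int_mult_0 int_mult_closed based_involution_def Pi_iff\<close>)
    moreover have "finsum ?R (\<lambda>b. [coeff x b] \<cdot> \<sigma> b) C \<in> ?S"
      using S.finsum_closed[of "\<lambda>b. [coeff x b] \<cdot> \<sigma> b" C] closed by simp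
    ultimately show "induced_map ?R C \<sigma> x = induced_map R B \<sigma> x" "induced_map ?R C \<sigma> x \<in> ?S"
      by simp_all
  qed
  have "based_involution ?R C \<sigma>"
    unfolding based_involution_def
  proof (intro conjI ballI)
    show "\<sigma> \<in> C \<rightarrow> C" by (rule \<sigma>C)
    show "\<sigma> (\<sigma> b) = b" if "b \<in> C" for b
      using that \<sigma> C by (auto simp: based_involution_def)
  next
    fix x y z assume "x \<in> carrier ?R" "y \<in> carrier ?R" "z \<in> carrier ?R"
    then have xyz: "x \<in> ?S" "y \<in> ?S" "z \<in> ?S" by simp_all
    with SR have "x \<in> carrier R" "y \<in> carrier R" "z \<in> carrier R" by auto
    with \<sigma>(1) have
      "basis_form R B (x \<otimes> y) z = basis_form R B x (z \<otimes> induced_map R B \<sigma> y)"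
      "basis_form R B (x \<otimes> y) z = basis_form R B y (induced_map R B \<sigma> x \<otimes> z)"
      unfolding based_involution_def by blast+
    with xyz show
      "basis_form ?R C (x \<otimes>\<^bsub>?R\<^esub> y) z = basis_form ?R C x (z \<otimes>\<^bsub>?R\<^esub> induced_map ?R C \<sigma> y)"
      "basis_form ?R C (x \<otimes>\<^bsub>?R\<^esub> y) z = basis_form ?R C y (induced_map ?R C \<sigma> x \<otimes>\<^bsub>?R\<^esub> z)"
      using map by (simp_all add: form mult)
  qed
  moreover have "coeff_fun ?R C (x \<otimes>\<^bsub>?R\<^esub> y) z \<ge> 0" if "x \<in> C" "y \<in> C" "z \<in> C" for x y z
    using that C CS mult structure_constants_nonneg by (auto simp: coeff' subset_iff)
  ultimately show ?thesis
    using C S subring_is_ring subring_int_basis[OF S C(1) refl]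
    by (auto intro!: based_ring.intro based_ring_axioms.intro)
qed

text \<open>The unit coefficient singles out the dual and is the same in a based subring, which therefore
  inherits the involution.\<close>

lemma star_subring:
  assumes "subring S R" "C \<subseteq> B" "S = int_span R C" "based_ring (R\<lparr>carrier := S\<rparr>) C" "x \<in> C"
  shows "star (R\<lparr>carrier := S\<rparr>) C x = dual x"
proof -
  interpret S: based_ring "R\<lparr>carrier := S\<rparr>" C by fact
  let ?y = "star (R\<lparr>carrier := S\<rparr>) C x"
  have y: "?y \<in> C" using assms(5) by simp
  have "x \<in> S" "?y \<in> S" using S.basis_closed[OF assms(5)] S.basis_closed[OF y] by simp_all
  then have "x \<otimes> ?y \<in> S" by (rule subringE(6)[OF assms(1)])
  then have "coeff (x \<otimes> ?y) \<one> = S.coeff (x \<otimes> ?y) \<one>"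
    using subring_coeff[OF assms(1,2,3)] by simp
  also have "\<dots> = 1"
    using S.coeff_mult_one[OF assms(5) y] by simp
  finally show ?thesis
    using coeff_mult_one[of x ?y] subsetD[OF assms(2) assms(5)] subsetD[OF assms(2) y]
    by (simp split: if_splits)
qed

text \<open>This reduces based subrings to subsets of a finite set, where intersections and comparisons
  are elementary. Closure under constituents expresses that a subring spanned by basic elements
  contains the products of these, and closure under duals comes from the agreement of the two
  involutions.\<close>

lemma based_subring_iff:
  "based_subring S R B \<longleftrightarrow> (\<exists>C. fusion_closed C \<and> S = int_span R C)"
proof
  assume "based_subring S R B"
  then obtain C where S: "subring S R" and C: "C \<subseteq> B" "S = int_span R C"
    and based: "based_ring (R\<lparr>carrier := S\<rparr>) C"
    by (auto simp: based_subring_def)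
  interpret S: based_ring "R\<lparr>carrier := S\<rparr>" C by fact
  have "\<one> \<in> C" using S.one_basic by simp
  moreover have "dual x \<in> C" if "x \<in> C" for x
    using star_subring[OF S C based that] S.dual_closed[OF that] by simp
  moreover have "z \<in> C" if "x \<in> C" "y \<in> C" "z \<in> B" "coeff (x \<otimes> y) z \<noteq> 0" for x y z
  proof -
    have "x \<otimes> y \<in> S"
      using that S.basis_closed[of x] S.basis_closed[of y] subringE(6)[OF S] by simp
    then show ?thesis using that C int_span_iff[of C] by blast
  qed
  ultimately have "fusion_closed C" using C(1) by (intro fusion_closedI)
  with C show "\<exists>C. fusion_closed C \<and> S = int_span R C" by blast
next
  assume "\<exists>C. fusion_closed C \<and> S = int_span R C"
  then obtain C where C: "fusion_closed C" "S = int_span R C" by blast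
  then show "based_subring S R B"
    unfolding based_subring_def
    using fusion_closedD(1)[OF C(1)] fusion_closed_subring[OF C(1)] fusion_closed_based_ring[OF C(1)]
    by blast
qed

lemma based_subring_basis:
  assumes "based_subring S R B"
  shows based_subring_fusion_closed: "fusion_closed (B \<inter> S)"
    and based_subring_span: "int_span R (B \<inter> S) = S"
proof -
  obtain C where "fusion_closed C" "S = int_span R C"
    using assms by (auto simp: based_subring_iff)
  moreover from this have "B \<inter> S = C"
    using basis_inter_int_span fusion_closedD(1) by blast
  ultimately show "fusion_closed (B \<inter> S)" "int_span R (B \<inter> S) = S" by simp_all
qed

lemma based_subring_subring: "based_subring S R B \<Longrightarrow> subring S R"
  by (simp add: based_subring_def)

lemma based_subring_one: "based_subring S R B \<Longrightarrow> \<one> \<in> S"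
  by (rule subringE(3)[OF based_subring_subring])

lemma based_subring_subset_iff:
  assumes "based_subring S R B" "based_subring T R B"
  shows "S \<subseteq> T \<longleftrightarrow> B \<inter> S \<subseteq> T"
proof
  assume "B \<inter> S \<subseteq> T"
  then show "S \<subseteq> T"
    using int_span_subset_subring[OF based_subring_subring[OF assms(2)], of "B \<inter> S"]
    by (simp add: based_subring_span[OF assms(1)])
qed blast

lemma based_subring_based_ring:
  assumes "based_subring S R B"
  shows "based_ring (R\<lparr>carrier := S\<rparr>) (B \<inter> S)"
  using fusion_closed_based_ring[OF based_subring_fusion_closed[OF assms]]
  by (simp add: based_subring_span[OF assms])

lemma based_subring_star:
  assumes "based_subring S R B" "x \<in> B \<inter> S"
  shows "star (R\<lparr>carrier := S\<rparr>) (B \<inter> S) x = dual x"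
  by (rule star_subring[OF based_subring_subring[OF assms(1)] Int_lower1
        based_subring_span[OF assms(1), symmetric] based_subring_based_ring[OF assms(1)] assms(2)])

lemma based_subring_carrier: "based_subring (carrier R) R B"
proof -
  have "fusion_closed B" by (rule fusion_closedI) (simp_all add: one_basic)
  then show ?thesis unfolding based_subring_iff by (intro exI[of _ B]) (simp add: int_span_basis)
qed

lemma based_subring_unit: "based_subring (int_span R {\<one>}) R B"
proof -
  have "fusion_closed {\<one>}"
    by (rule fusion_closedI) (auto simp: one_basic dual_one coeff_basic split: if_splits)
  then show ?thesis unfolding based_subring_iff by (intro exI[of _ "{\<one>}"]) simp
qed

lemma based_subring_Inter:
  assumes "\<S> \<noteq> {}" "\<And>S. S \<in> \<S> \<Longrightarrow> based_subring S R B"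
  shows "based_subring (\<Inter>\<S>) R B"
proof -
  let ?\<C> = "(\<lambda>S. B \<inter> S) ` \<S>"
  have closed: "fusion_closed C" if "C \<in> ?\<C>" for C
    using that assms(2) based_subring_fusion_closed by auto
  have "int_span R (\<Inter>?\<C>) = (\<Inter>C\<in>?\<C>. int_span R C)"
    using assms(1) by (intro int_span_Inter[symmetric]) auto
  also have "\<dots> = \<Inter>\<S>"
    using assms(2) by (simp add: based_subring_span)
  finally have "\<Inter>\<S> = int_span R (\<Inter>?\<C>)" ..
  moreover have "fusion_closed (\<Inter>?\<C>)"
  proof (rule fusion_closedI)
    show "\<Inter>?\<C> \<subseteq> B" using assms(1) by auto
    show "\<one> \<in> \<Inter>?\<C>" using closed fusion_closedD(2) by blast
    show "dual x \<in> \<Inter>?\<C>" if "x \<in> \<Inter>?\<C>" for x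
      using that closed fusion_closedD(3) by blast
    show "z \<in> \<Inter>?\<C>"
      if "x \<in> \<Inter>?\<C>" "y \<in> \<Inter>?\<C>" "z \<in> B" "coeff (x \<otimes> y) z \<noteq> 0" for x y z
    proof (rule InterI)
      fix C assume C: "C \<in> ?\<C>"
      show "z \<in> C"
        using that(1,2) C by (intro fusion_closedD(4)[OF closed[OF C] _ _ that(3,4)]) blast+
    qed
  qed
  ultimately show ?thesis unfolding based_subring_iff by blast
qed

lemma based_subring_generated:
  assumes "A \<subseteq> carrier R"
  shows "based_subring (based_generated R B A) R B"
  unfolding based_generated_def
proof (rule based_subring_Inter)
  have "carrier R \<in> {S. based_subring S R B \<and> A \<subseteq> S}"
    using assms based_subring_carrier by simp
  then show "{S. based_subring S R B \<and> A \<subseteq> S} \<noteq> {}" by (metis empty_iff)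
qed simp

lemma based_generated_subset_iff:
  assumes "based_subring S R B"
  shows "based_generated R B A \<subseteq> S \<longleftrightarrow> A \<subseteq> S"
  using assms unfolding based_generated_def by blast

text \<open>Each term of the upper central series is formed inside the previous one. This lemma lets all
  of them be treated as based subrings of \<open>R\<close>.\<close>

lemma based_subring_relative_iff:
  assumes "based_subring T R B"
  shows "based_subring S (R\<lparr>carrier := T\<rparr>) (B \<inter> T) \<longleftrightarrow> based_subring S R B \<and> S \<subseteq> T"
proof -
  have T: "subring T R" using assms by (rule based_subring_subring)
  interpret T: based_ring "R\<lparr>carrier := T\<rparr>" "B \<inter> T"
    using assms by (rule based_subring_based_ring)
  have TR: "T \<subseteq> carrier R" using T by (rule subringE)
  have subring: "subring S (R\<lparr>carrier := T\<rparr>) \<longleftrightarrow> subring S R" if "S \<subseteq> T"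
    using that TR T.subring_iff[of S] subring_iff[of S] by simp
  have span: "int_span (R\<lparr>carrier := T\<rparr>) C = int_span R C" if "C \<subseteq> T" for C
    using T that by (rule subring_int_span)
  show ?thesis
  proof
    assume S: "based_subring S (R\<lparr>carrier := T\<rparr>) (B \<inter> T)"
    then obtain C where C: "C \<subseteq> B \<inter> T" "S = int_span (R\<lparr>carrier := T\<rparr>) C"
      and based: "based_ring (R\<lparr>carrier := T\<rparr>\<lparr>carrier := S\<rparr>) C"
      by (auto simp: based_subring_def)
    have sub: "subring S (R\<lparr>carrier := T\<rparr>)" using S by (simp add: based_subring_def)
    then have ST: "S \<subseteq> T" using subringE(1) by fastforce
    have "C \<subseteq> B" "S = int_span R C" "based_ring (R\<lparr>carrier := S\<rparr>) C"
      using C based span by simp_all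
    moreover have "subring S R" using sub subring[OF ST] by simp
    ultimately show "based_subring S R B \<and> S \<subseteq> T"
      using ST unfolding based_subring_def by (intro conjI exI[of _ C])
  next
    assume "based_subring S R B \<and> S \<subseteq> T"
    then have S: "based_subring S R B" and ST: "S \<subseteq> T" by simp_all
    have "B \<inter> S \<subseteq> B \<inter> T" using ST by auto
    moreover have "S = int_span (R\<lparr>carrier := T\<rparr>) (B \<inter> S)"
      using based_subring_span[OF S] span[of "B \<inter> S"] ST by auto
    moreover have "based_ring (R\<lparr>carrier := T\<rparr>\<lparr>carrier := S\<rparr>) (B \<inter> S)"
      using based_subring_based_ring[OF S] by simp
    moreover have "subring S (R\<lparr>carrier := T\<rparr>)"
      using subring[OF ST] based_subring_subring[OF S] by simp
    ultimately show "based_subring S (R\<lparr>carrier := T\<rparr>) (B \<inter> T)"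
      unfolding based_subring_def by (intro conjI exI[of _ "B \<inter> S"])
  qed
qed

section \<open>Adjoint subring and commutator\<close>

lemma based_subring_adjoint:
  assumes "based_subring T R B"
  shows "based_subring (adjoint_subring (R\<lparr>carrier := T\<rparr>) (B \<inter> T)) R B"
proof -
  interpret T: based_ring "R\<lparr>carrier := T\<rparr>" "B \<inter> T"
    using assms by (rule based_subring_based_ring)
  have "based_subring (adjoint_subring (R\<lparr>carrier := T\<rparr>) (B \<inter> T)) (R\<lparr>carrier := T\<rparr>) (B \<inter> T)"
    unfolding adjoint_subring_def
  proof (rule T.based_subring_generated, rule subsetI)
    fix z assume "z \<in> {x \<otimes>\<^bsub>R\<lparr>carrier := T\<rparr>\<^esub> T.dual x |x. x \<in> B \<inter> T}"
    then obtain x where "z = x \<otimes>\<^bsub>R\<lparr>carrier := T\<rparr>\<^esub> T.dual x" and x: "x \<in> B \<inter> T" by blast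
    then show "z \<in> carrier (R\<lparr>carrier := T\<rparr>)"
      using T.m_closed[OF T.basis_closed[OF x] T.basis_closed[OF T.dual_closed[OF x]]] by simp
  qed
  then show ?thesis using assms by (simp add: based_subring_relative_iff)
qed

text \<open>The adjoint subring of \<open>T\<close> is generated inside \<open>T\<close>, while \<open>S\<close> need not lie in
  \<open>T\<close>; it is compared with \<open>S \<inter> T\<close>, which contains the same generators as \<open>S\<close>.\<close>

lemma adjoint_subset_iff:
  assumes T: "based_subring T R B" and S: "based_subring S R B"
  shows "adjoint_subring (R\<lparr>carrier := T\<rparr>) (B \<inter> T) \<subseteq> S \<longleftrightarrow> (\<forall>x\<in>B \<inter> T. x \<otimes> dual x \<in> S)"
proof -
  let ?R = "R\<lparr>carrier := T\<rparr>" and ?A = "{x \<otimes> dual x |x. x \<in> B \<inter> T}"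
  interpret T: based_ring ?R "B \<inter> T"
    using T by (rule based_subring_based_ring)
  have "x \<otimes>\<^bsub>?R\<^esub> star ?R (B \<inter> T) x = x \<otimes> dual x" if "x \<in> B \<inter> T" for x
    using based_subring_star[OF T that] by simp
  then have "{x \<otimes>\<^bsub>?R\<^esub> star ?R (B \<inter> T) x |x. x \<in> B \<inter> T} = ?A"
    by (intro Collect_cong) (metis (no_types, lifting))
  then have gen: "adjoint_subring ?R (B \<inter> T) = based_generated ?R (B \<inter> T) ?A"
    by (simp add: adjoint_subring_def)
  have AT: "?A \<subseteq> T"
  proof
    fix z assume "z \<in> ?A"
    then obtain x where z: "z = x \<otimes> dual x" and x: "x \<in> B \<inter> T" by blast
    have "dual x \<in> T" using T.dual_closed[OF x] based_subring_star[OF T x] by simp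
    then show "z \<in> T"
      using x unfolding z by (intro subringE(6)[OF based_subring_subring[OF T]]) auto
  qed
  have "based_subring (S \<inter> T) R B"
    using based_subring_Inter[of "{S, T}"] S T by auto
  then have ST: "based_subring (S \<inter> T) ?R (B \<inter> T)"
    using T by (simp add: based_subring_relative_iff)
  have TT: "based_subring T ?R (B \<inter> T)"
    using T by (simp add: based_subring_relative_iff)
  have "adjoint_subring ?R (B \<inter> T) \<subseteq> S \<longleftrightarrow> adjoint_subring ?R (B \<inter> T) \<subseteq> S \<inter> T"
    using T.based_generated_subset_iff[OF TT, of ?A] AT by (auto simp: gen)
  also have "\<dots> \<longleftrightarrow> ?A \<subseteq> S \<inter> T"
    unfolding gen by (rule T.based_generated_subset_iff[OF ST])
  finally show ?thesis using AT by auto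
qed

end

context comm_based_ring
begin

text \<open>If \<open>x\<close> is a constituent of \<open>yz\<close>, then \<open>x\<^sup>*\<close> is one of \<open>z\<^sup>*y\<^sup>*\<close> with the same
  multiplicity \<open>c \<ge> 1\<close>, so that every constituent of \<open>xx\<^sup>*\<close> is one of
  \<open>yzz\<^sup>*y\<^sup>* = (yy\<^sup>*)(zz\<^sup>*)\<close>, a product of two elements of \<open>S\<close>.\<close>

lemma fusion_closed_commutator:
  assumes S: "based_subring S R B"
  shows "fusion_closed {y \<in> B. y \<otimes> dual y \<in> S}"
proof (rule fusion_closedI)
  let ?D = "{y \<in> B. y \<otimes> dual y \<in> S}"
  show "?D \<subseteq> B" by auto
  show "\<one> \<in> ?D" using based_subring_one[OF S] by (simp add: one_basic dual_one)
  show "dual y \<in> ?D" if "y \<in> ?D" for y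
    using that m_comm[of y "dual y"] by simp
  fix y z x assume y: "y \<in> ?D" and z: "z \<in> ?D" and x: "x \<in> B" and ne: "coeff (y \<otimes> z) x \<noteq> 0"
  have B: "y \<in> B" "z \<in> B" "dual y \<in> B" "dual z \<in> B" "dual x \<in> B"
    using y z x by auto
  have pos: "coeff (y \<otimes> z) x \<ge> 1"
    using ne structure_constants_nonneg[of y z x] B x by simp
  have "(y \<otimes> z) \<otimes> (dual z \<otimes> dual y) = (y \<otimes> dual y) \<otimes> (z \<otimes> dual z)"
    using B by (simp add: m_ac)
  also have "\<dots> \<in> S"
    using y z subringE(6)[OF based_subring_subring[OF S]] by simp
  finally have prod: "(y \<otimes> z) \<otimes> (dual z \<otimes> dual y) \<in> S" .
  have "coeff (x \<otimes> dual x) w = 0" if w: "w \<in> B - (B \<inter> S)" for w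
  proof -
    let ?c = "coeff (y \<otimes> z) x"
    have "coeff (x \<otimes> dual x) w \<ge> 0"
      using structure_constants_nonneg[of x "dual x" w] x B w by simp
    moreover from this have "coeff (x \<otimes> dual x) w \<le> ?c * ?c * coeff (x \<otimes> dual x) w"
      using mult_right_mono[of 1 "?c * ?c" "coeff (x \<otimes> dual x) w"] mult_mono[of 1 ?c 1 ?c] pos by simp
    moreover have "?c * ?c * coeff (x \<otimes> dual x) w
        \<le> coeff ((y \<otimes> z) \<otimes> (dual z \<otimes> dual y)) w"
      using coeff_mult_ge[of "y \<otimes> z" "dual z \<otimes> dual y" x "dual x" w]
        coeff_mult_dual_swap[OF x B(1,2)] structure_constants_nonneg B x w by simp
    moreover have "coeff ((y \<otimes> z) \<otimes> (dual z \<otimes> dual y)) w = 0"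
      using prod w int_span_iff[of "B \<inter> S"] based_subring_span[OF S] by blast
    ultimately show ?thesis by simp
  qed
  then have "x \<otimes> dual x \<in> int_span R (B \<inter> S)"
    using int_span_iff[of "B \<inter> S"] x B by simp
  then show "x \<in> ?D" using x based_subring_span[OF S] by simp
qed

lemma based_subring_commutator: "based_subring (commutator R B S) R B"
  unfolding commutator_def by (rule based_subring_generated) auto

lemma commutator_eq_span:
  assumes S: "based_subring S R B"
  shows "commutator R B S = int_span R {y \<in> B. y \<otimes> dual y \<in> S}"
proof
  let ?D = "{y \<in> B. y \<otimes> dual y \<in> S}"
  have span: "based_subring (int_span R ?D) R B"
    using fusion_closed_commutator[OF S] based_subring_iff by blast
  then show "commutator R B S \<subseteq> int_span R ?D"
    unfolding commutator_def using int_span_superset[of ?D] by (simp add: based_generated_subset_iff)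
  have "?D \<subseteq> commutator R B S"
    by (auto simp: commutator_def based_generated_def)
  then show "int_span R ?D \<subseteq> commutator R B S"
    by (rule int_span_subset_subring[OF based_subring_subring[OF based_subring_commutator]])
qed

lemma basis_inter_commutator:
  assumes "based_subring S R B"
  shows "B \<inter> commutator R B S = {y \<in> B. y \<otimes> dual y \<in> S}"
  unfolding commutator_eq_span[OF assms] by (rule basis_inter_int_span) auto

text \<open>Both inclusions say that \<open>xx\<^sup>* \<in> S\<close> for all basic \<open>x\<close> in \<open>T\<close>.\<close>

lemma adjoint_commutator_galois:
  assumes "based_subring T R B" "based_subring S R B"
  shows "adjoint_subring (R\<lparr>carrier := T\<rparr>) (B \<inter> T) \<subseteq> S \<longleftrightarrow> T \<subseteq> commutator R B S"
proof -
  have "T \<subseteq> commutator R B S \<longleftrightarrow> B \<inter> T \<subseteq> B \<inter> commutator R B S"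
    using based_subring_subset_iff[OF assms(1) based_subring_commutator] by simp
  then show ?thesis
    unfolding adjoint_subset_iff[OF assms] basis_inter_commutator[OF assms(2)] by auto
qed

section \<open>Central series\<close>

lemma based_subring_upper_central: "based_subring (upper_central R B k) R B"
  by (induction k) (simp_all add: based_subring_carrier based_subring_adjoint)

lemma based_subring_lower_central: "based_subring (lower_central R B k) R B"
  by (induction k) (simp_all add: based_subring_unit based_subring_commutator)

text \<open>Each application of the Galois connection trades one step down the upper series for one step
  up the lower series.\<close>

lemma upper_central_shift:
  "upper_central R B (k + j) \<subseteq> lower_central R B m \<longleftrightarrow>
    upper_central R B k \<subseteq> lower_central R B (m + j)"
proof (induction j arbitrary: m)
  case (Suc j)
  have "upper_central R B (k + Suc j) \<subseteq> lower_central R B m \<longleftrightarrow>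
      upper_central R B (k + j) \<subseteq> lower_central R B (Suc m)"
    by (simp add: adjoint_commutator_galois based_subring_upper_central based_subring_lower_central)
  then show ?case using Suc[of "Suc m"] by simp
qed simp

end

theorem theorem4p16:
  fixes R :: "('a, 'm) ring_scheme" (structure) and B :: "'a set" and n :: nat
  assumes "comm_based_ring R B"
  shows "(upper_central R B n = int_span R {\<one>} \<longleftrightarrow> lower_central R B n = carrier R) \<and>
    (upper_central R B n = int_span R {\<one>} \<longrightarrow>
      (\<forall>k\<le>n. upper_central R B k \<subseteq> lower_central R B (n - k)))"
proof -
  interpret comm_based_ring R B by fact
  have "int_span R {\<one>} \<subseteq> upper_central R B n"
    using based_subring_one[OF based_subring_upper_central]
    by (intro int_span_subset_subring based_subring_subring[OF based_subring_upper_central]) simp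
  then have upper: "upper_central R B n = int_span R {\<one>} \<longleftrightarrow>
      upper_central R B n \<subseteq> lower_central R B 0"
    by auto
  have "lower_central R B n \<subseteq> carrier R"
    using based_subring_subring[OF based_subring_lower_central] by (rule subringE)
  then have lower: "lower_central R B n = carrier R \<longleftrightarrow>
      upper_central R B 0 \<subseteq> lower_central R B n"
    by auto
  have "upper_central R B n \<subseteq> lower_central R B 0 \<longleftrightarrow>
      upper_central R B k \<subseteq> lower_central R B (n - k)" if "k \<le> n" for k
    using that upper_central_shift[of k "n - k" 0] by simp
  with upper lower show ?thesis by (metis diff_zero zero_le)
qed

end
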